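(* Assume the weak form of Szpiro's conjecture. Let $s>0$ be a fixed positive integer and let $$f(x,y)=x^{2s}y^s\pm y^{2s}x^s$$ (for a fixed choice of sign). Let $p_1<\dots<p_q$ be fixed primes, let $b$ be a fixed non-zero integer, and let $l\geq1$ and $A_1,\dots,A_l$ be fixed positive integers. Assume $f(x,y)$ has at least three pairwise non-proportional linear factors over $\mathbb{C}$. Then the equation $$b\,p_1^{z_1}\cdots p_q^{z_q}\cdot n_1!A_1^{n_1}\cdots n_l!A_l^{n_l}=f(x,y)$$ has only finitely many integer solutions $(z_1,\dots,z_q,n_1,\dots,n_l,x,y)$ with all $z_i\geq 0$, all $n_j>0$, and $\gcd(x,y)=1$.
   Context: For a non-zero integer $a$, the radical is $N(a)=\prod_{p\mid a}p$ (product over the distinct primes dividing $a$). The weak form of Szpiro's conjecture is the statement: there exists a constant $s'>0$ such that for all pairwise coprime integers $A,B,C$ with $A+B=C$ one has $|ABC|<N(ABC)^{s'}$. *)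

theory Defs
  imports Complex_Main "HOL-Computational_Algebra.Computational_Algebra"
begin

text \<open>Elements of \<^term>\<open>prime_factors a\<close> are normalized, i.e. positive primes.\<close>

definition int_radical :: "int \<Rightarrow> int"
  where "int_radical a = (\<Prod>p\<in>prime_factors a. p)"

text \<open>
  The radical is only meaningful for non-zero integers, so the conjecture concerns non-zero
  \<open>A\<close>, \<open>B\<close>, \<open>C\<close>; this excludes the degenerate pairwise coprime triples such as \<open>(0, 1, 1)\<close>.
\<close>

definition weak_szpiro :: bool
  where "weak_szpiro \<longleftrightarrow>
    (\<exists>s'::real. s' > 0 \<and>
      (\<forall>A B C :: int. A \<noteq> 0 \<and> B \<noteq> 0 \<and> C \<noteq> 0 \<and>
         coprime A B \<and> coprime A C \<and> coprime B C \<and> A + B = C \<longrightarrow>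
         real_of_int \<bar>A * B * C\<bar> < real_of_int (int_radical (A * B * C)) powr s'))"

text \<open>
  The form with sign \<open>\<epsilon> = \<plusminus>1\<close>, over any commutative ring: it is evaluated both at integers and at
  the indeterminates of the polynomial ring below.
\<close>

definition binary_form :: "int \<Rightarrow> nat \<Rightarrow> 'a::comm_ring_1 \<Rightarrow> 'a \<Rightarrow> 'a"
  where "binary_form \<epsilon> s x y = x ^ (2 * s) * y ^ s + of_int \<epsilon> * (y ^ (2 * s) * x ^ s)"

text \<open>
  The ring of bivariate complex polynomials is represented as \<open>\<complex>[X][Y]\<close>: the inner variable is
  \<open>X\<close>, the outer one is \<open>Y\<close>.
\<close>

definition const2 :: "complex \<Rightarrow> complex poly poly"
  where "const2 c = [:[:c:]:]"

definition X_var :: "complex poly poly"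
  where "X_var = [:[:0, 1:]:]"

definition Y_var :: "complex poly poly"
  where "Y_var = [:0, 1:]"

definition is_linear_form :: "complex poly poly \<Rightarrow> bool"
  where "is_linear_form L \<longleftrightarrow>
    L \<noteq> 0 \<and> (\<exists>\<alpha> \<beta>. L = const2 \<alpha> * X_var + const2 \<beta> * Y_var)"

definition proportional :: "complex poly poly \<Rightarrow> complex poly poly \<Rightarrow> bool"
  where "proportional L M \<longleftrightarrow> (\<exists>c. c \<noteq> 0 \<and> L = const2 c * M)"

text \<open>
  For homogeneous \<open>F\<close> every factor of degree one is homogeneous, so it is enough to consider
  linear forms.
\<close>

definition three_linear_factors :: "complex poly poly \<Rightarrow> bool"
  where "three_linear_factors F \<longleftrightarrow>
    (\<exists>L\<^sub>1 L\<^sub>2 L\<^sub>3.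
       is_linear_form L\<^sub>1 \<and> is_linear_form L\<^sub>2 \<and> is_linear_form L\<^sub>3 \<and>
       L\<^sub>1 dvd F \<and> L\<^sub>2 dvd F \<and> L\<^sub>3 dvd F \<and>
       \<not> proportional L\<^sub>1 L\<^sub>2 \<and> \<not> proportional L\<^sub>1 L\<^sub>3 \<and> \<not> proportional L\<^sub>2 L\<^sub>3)"

end

theory Submission
  imports Defs
begin

text \<open>
  Since \<open>f(x, y) = x\<^sup>s y\<^sup>s (x\<^sup>s \<plusminus> y\<^sup>s)\<close>, the triple \<open>A = x\<^sup>s\<close>, \<open>B = \<plusminus>y\<^sup>s\<close>,
  \<open>C = A + B\<close> is pairwise coprime with \<open>\<bar>ABC\<bar> = \<bar>f(x, y)\<bar>\<close>. If \<open>M\<close> is the largest of the \<open>n\<^sub>j\<close>,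
  the radical of the left-hand side of the equation is at most a constant times the primorial of
  \<open>M\<close>, hence at most \<open>K 4\<^sup>M\<close>, while the left-hand side is at least \<open>M!\<close>. Szpiro's inequality
  \<open>M! < (K 4\<^sup>M) powr s'\<close> bounds \<open>M\<close>, hence the radical, hence \<open>\<bar>f(x, y)\<bar>\<close>, and everything else
  divides \<open>f(x, y)\<close>.
\<close>

section \<open>Chebyshev-type bound for the primorial\<close>

lemma prod_primes_dvd:
  fixes k :: nat
  assumes "finite S" "\<And>p. p \<in> S \<Longrightarrow> prime p" "\<And>p. p \<in> S \<Longrightarrow> p dvd k"
  shows "\<Prod>S dvd k"
  using assms
proof (induction S rule: finite_induct)
  case (insert p S)
  have "coprime p (\<Prod>S)"
    by (intro prod_coprime_right) (metis insert.hyps(2) insert.prems(1) insertCI primes_coprime)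
  then show ?case
    using insert by (simp add: divides_mult)
qed simp

text \<open>The two middle coefficients of row \<open>2 * m + 1\<close> are equal, and together they
  are at most the row sum \<open>2 * 4 ^ m\<close>.\<close>

lemma binomial_odd_le: "(2 * m + 1) choose m \<le> 4 ^ m"
proof -
  have "((2 * m + 1) choose m) + ((2 * m + 1) choose (m + 1))
      = (\<Sum>k\<in>{m, m + 1}. (2 * m + 1) choose k)"
    by simp
  also have "\<dots> \<le> (\<Sum>k\<le>2 * m + 1. (2 * m + 1) choose k)"
    by (rule sum_mono2) auto
  also have "\<dots> = 2 ^ (2 * m + 1)"
    by (rule choose_row_sum)
  also have "\<dots> = 2 * 4 ^ m"
    by (simp add: power_mult)
  finally have "((2 * m + 1) choose m) + ((2 * m + 1) choose (m + 1)) \<le> 2 * 4 ^ m" .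
  moreover have "(2 * m + 1) choose (m + 1) = (2 * m + 1) choose m"
    by (subst binomial_symmetric) auto
  ultimately show ?thesis
    by linarith
qed

text \<open>Erdos's argument by strong induction. An even \<open>n > 2\<close> adds no prime. For
  \<open>n = 2 * m + 1\<close> the primes up to \<open>m + 1\<close> are covered by the induction
  hypothesis, and those above it all divide one binomial coefficient of size at most
  \<open>4 ^ m\<close>.\<close>

lemma primorial_le: "\<Prod>{p::nat. prime p \<and> p \<le> n} \<le> 4 ^ n"
proof (induction n rule: less_induct)
  case (less n)
  consider "n < 2" | "n = 2" | "n > 2" "even n" | "n > 2" "odd n"
    using linorder_less_linear[of n 2] by blast
  then show ?case
  proof cases
    case 1
    then have "{p::nat. prime p \<and> p \<le> n} = {}"
      by (auto dest: prime_ge_2_nat)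
    then show ?thesis by (simp only: prod.empty) simp
  next
    case 2
    then have "{p::nat. prime p \<and> p \<le> n} = {2}"
      by (auto dest: prime_ge_2_nat)
    then show ?thesis using 2 by simp
  next
    case 3
    then have "\<not> prime n"
      using prime_odd_nat by blast
    then have "{p::nat. prime p \<and> p \<le> n} = {p. prime p \<and> p \<le> n - 1}"
      using 3 by (auto simp: le_less)
    also have "\<Prod>\<dots> \<le> 4 ^ (n - 1)"
      using less 3 by simp
    also have "\<dots> \<le> (4::nat) ^ n"
      by (rule power_increasing) auto
    finally show ?thesis .
  next
    case 4
    then obtain m where n: "n = 2 * m + 1"
      by (blast elim: oddE)
    with 4 have "m > 0" by simp
    let ?S = "{p. prime p \<and> m + 1 < p \<and> p \<le> 2 * m + 1}"
    \<comment> \<open>Such a \<open>p\<close> divides \<open>(2 * m + 1)!\<close> but, being larger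
      than \<open>m + 1\<close>, neither of the factorials in the denominator.\<close>
    have "p dvd ((2 * m + 1) choose m)" if "p \<in> ?S" for p
    proof -
      have "p dvd (fact (2 * m + 1) :: nat)"
        using that by (simp add: prime_dvd_fact_iff del: fact_Suc)
      also have "(fact (2 * m + 1) :: nat) = fact m * fact (m + 1) * ((2 * m + 1) choose m)"
        using binomial_fact_lemma[of m "2 * m + 1"] by (simp del: fact_Suc)
      finally show ?thesis
        using that by (simp add: prime_dvd_mult_iff prime_dvd_fact_iff del: fact_Suc)
    qed
    then have "\<Prod>?S dvd ((2 * m + 1) choose m)"
      by (intro prod_primes_dvd) auto
    then have "\<Prod>?S \<le> (2 * m + 1) choose m"
      by (intro dvd_imp_le) (auto simp: zero_less_binomial_iff)
    also have "\<dots> \<le> 4 ^ m"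
      by (rule binomial_odd_le)
    finally have S: "\<Prod>?S \<le> 4 ^ m" .
    have "{p. prime p \<and> p \<le> n} = {p. prime p \<and> p \<le> m + 1} \<union> ?S"
      using n by auto
    then have "\<Prod>{p. prime p \<and> p \<le> n} = \<Prod>{p. prime p \<and> p \<le> m + 1} * \<Prod>?S"
      by (simp only:) (rule prod.union_disjoint; auto)
    \<comment> \<open>The induction hypothesis applies at \<open>m + 1\<close> because
      \<open>m > 0\<close> gives \<open>m + 1 < 2 * m + 1\<close>.\<close>
    also have "\<dots> \<le> 4 ^ (m + 1) * 4 ^ m"
      by (intro mult_le_mono S less.IH) (use n \<open>m > 0\<close> in simp)
    also have "\<dots> = 4 ^ n"
      by (simp add: n mult_2 flip: power_add)
    finally show ?thesis .
  qed
qed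

section \<open>Bounds for the radical and growth of the factorial\<close>

lemma int_radical_pos: "int_radical a > 0"
  unfolding int_radical_def by (rule prod_pos) (auto intro: prime_gt_0_int dest: in_prime_factors_imp_prime)

text \<open>Every prime factor of \<open>a\<close> lies among the prime factors of \<open>c\<close>
  or the primes up to \<open>M\<close>, and the latter multiply to at most \<open>4 ^ M\<close>. In
  the application \<open>c\<close> is the same for all solutions, so only \<open>M\<close>
  varies.\<close>

lemma int_radical_le:
  assumes "c \<noteq> 0"
    and "\<And>p. prime p \<Longrightarrow> p dvd a \<Longrightarrow> p dvd c \<or> p \<le> int M"
  shows "int_radical a \<le> int_radical c * 4 ^ M"
proof -
  let ?T = "int ` {p. prime p \<and> p \<le> M}"
  have fin: "finite ?T" by simp
  have ge: "1 \<le> p" if "p \<in> prime_factors c \<union> ?T" for p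
    using that by (auto dest!: in_prime_factors_imp_prime prime_ge_1_int prime_ge_1_nat)
  have sub: "prime_factors a \<subseteq> prime_factors c \<union> ?T"
  proof
    fix p assume "p \<in> prime_factors a"
    then have p: "prime p" "p dvd a"
      by (auto simp: prime_factors_dvd)
    show "p \<in> prime_factors c \<union> ?T"
    proof (cases "p dvd c")
      case True
      then show ?thesis using p assms(1) by (simp add: prime_factors_dvd)
    next
      case False
      then have "p \<le> int M" using assms(2) p by blast
      then have "p = int (nat p)" "prime (nat p)" "nat p \<le> M"
        using iffD1[OF prime_int_nat_transfer p(1)] by auto
      then show ?thesis by blast
    qed
  qed
  have ge1: "1 \<le> \<Prod>X" if "X \<subseteq> prime_factors c \<union> ?T" for X
    using that ge by (intro prod_ge_1) blast
  have "int_radical a \<le> \<Prod>(prime_factors c \<union> ?T)"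
    unfolding int_radical_def
    by (rule prod_mono2) (use sub fin ge in \<open>auto intro: prime_ge_0_int dest: in_prime_factors_imp_prime\<close>)
  \<comment> \<open>The two sets of primes may overlap; the extra factor over the intersection is at
    least 1 and turns the product over the union into a product of two products.\<close>
  also have "\<dots> \<le> \<Prod>(prime_factors c \<union> ?T) * \<Prod>(prime_factors c \<inter> ?T)"
    using ge1[of "prime_factors c \<union> ?T"] ge1[of "prime_factors c \<inter> ?T"]
    by (simp add: le_infI1 mult_le_cancel_left1)
  also have "\<dots> = int_radical c * \<Prod>?T"
    unfolding int_radical_def by (rule prod.union_inter) auto
  also have "\<Prod>?T = int (\<Prod>{p. prime p \<and> p \<le> M})"
    by (simp add: prod.reindex)
  also have "int_radical c * \<dots> \<le> int_radical c * int (4 ^ M)"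
    using primorial_le[of M] int_radical_pos[of c]
    by (intro mult_left_mono) (auto simp del: of_nat_prod of_nat_power)
  finally show ?thesis by simp
qed

text \<open>The right-hand side equals \<open>K powr t * (4 powr t) ^ M\<close>, a geometric
  progression in \<open>M\<close>, and the factorial outgrows it: the terms of the exponential
  series at \<open>4 powr t\<close> tend to 0.\<close>

lemma fact_less_powr_bounded:
  fixes K t :: real
  assumes "K > 0"
  obtains N where "\<And>M. fact M < (K * 4 ^ M) powr t \<Longrightarrow> M \<le> N"
proof -
  let ?c = "4 powr t"
  have "(\<lambda>M. ?c ^ M / fact M) \<longlonglongrightarrow> 0"
    using summable_LIMSEQ_zero[OF summable_exp[of ?c]] by (simp add: field_simps)
  then have "eventually (\<lambda>M. ?c ^ M / fact M < 1 / K powr t) sequentially"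
    using assms by (intro order_tendstoD(2)) auto
  then obtain N where N: "\<And>M. M \<ge> N \<Longrightarrow> ?c ^ M / fact M < 1 / K powr t"
    unfolding eventually_sequentially by blast
  have "M \<le> N" if "fact M < (K * 4 ^ M) powr t" for M
  proof (rule ccontr)
    assume "\<not> M \<le> N"
    then have "?c ^ M / fact M < 1 / K powr t"
      using N by simp
    then have "K powr t * ?c ^ M < fact M"
      using assms by (simp add: field_simps)
    moreover have "(K * 4 ^ M) powr t = K powr t * ?c ^ M"
      using assms by (simp add: powr_mult powr_powr mult.commute flip: powr_realpow)
    ultimately show False using that by simp
  qed
  then show ?thesis by (rule that)
qed

section \<open>The binary form and Szpiro's inequality\<close>

lemma binary_form_factor:
  "binary_form \<epsilon> s x y = x ^ s * y ^ s * (x ^ s + of_int \<epsilon> * y ^ s)"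
  unfolding binary_form_def mult_2 power_add by (simp add: algebra_simps)

text \<open>The product of the triple is \<open>\<epsilon>\<close> times the form, and a sign
  changes neither radical nor absolute value. A nonzero form makes all three members of the triple
  nonzero, as the conjecture requires.\<close>

lemma szpiro_binary_form:
  fixes x y \<epsilon> :: int and t :: real
  assumes szpiro: "\<And>A B C :: int. A \<noteq> 0 \<Longrightarrow> B \<noteq> 0 \<Longrightarrow> C \<noteq> 0 \<Longrightarrow> coprime A B \<Longrightarrow> coprime A C \<Longrightarrow>
      coprime B C \<Longrightarrow> A + B = C \<Longrightarrow>
      real_of_int \<bar>A * B * C\<bar> < real_of_int (int_radical (A * B * C)) powr t"
    and \<epsilon>: "\<epsilon> = 1 \<or> \<epsilon> = -1" and "gcd x y = 1" and nz: "binary_form \<epsilon> s x y \<noteq> 0"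
  shows "real_of_int \<bar>binary_form \<epsilon> s x y\<bar>
    < real_of_int (int_radical (binary_form \<epsilon> s x y)) powr t"
proof -
  let ?A = "x ^ s" and ?B = "\<epsilon> * y ^ s"
  have cop: "coprime ?A ?B"
    using \<epsilon> \<open>gcd x y = 1\<close> by (auto simp: coprime_iff_gcd_eq_1)
  have "coprime ?A (?A + ?B)" "coprime ?B (?A + ?B)"
    using cop unfolding coprime_iff_gcd_eq_1 by (metis gcd_add2 add.commute gcd.commute)+
  moreover have "?A * ?B * (?A + ?B) = \<epsilon> * binary_form \<epsilon> s x y"
    by (simp add: binary_form_factor)
  moreover have "int_radical (\<epsilon> * binary_form \<epsilon> s x y) = int_radical (binary_form \<epsilon> s x y)"
    using \<epsilon> by (auto simp: int_radical_def)
  moreover have "\<bar>\<epsilon> * binary_form \<epsilon> s x y\<bar> = \<bar>binary_form \<epsilon> s x y\<bar>"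
    using \<epsilon> by auto
  ultimately show ?thesis
    using szpiro[of ?A ?B "?A + ?B"] cop nz \<epsilon> by (auto simp: binary_form_factor)
qed

theorem theorem1p12:
  fixes s :: nat and \<epsilon> b :: int and ps As :: "nat list"
  assumes "weak_szpiro"
    and "s > 0"
    and "\<epsilon> = 1 \<or> \<epsilon> = -1"
    and "sorted_wrt (<) ps" and "\<forall>p\<in>set ps. prime p"
    and "b \<noteq> 0"
    and "length As \<ge> 1" and "\<forall>a\<in>set As. a > 0"
    and "three_linear_factors (binary_form \<epsilon> s X_var Y_var)"
  shows "finite {(zs :: nat list, ns :: nat list, x :: int, y :: int).
           length zs = length ps \<and> length ns = length As \<and>
           (\<forall>n\<in>set ns. n > 0) \<and> gcd x y = 1 \<and>
           b * (\<Prod>i<length ps. int (ps ! i) ^ (zs ! i))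
             * (\<Prod>j<length As. fact (ns ! j) * int (As ! j) ^ (ns ! j))
           = binary_form \<epsilon> s x y}"
    (is "finite ?Sol")
proof -
  obtain t :: real where "t > 0" and
    szpiro: "\<And>A B C :: int. A \<noteq> 0 \<Longrightarrow> B \<noteq> 0 \<Longrightarrow> C \<noteq> 0 \<Longrightarrow> coprime A B \<Longrightarrow> coprime A C \<Longrightarrow>
      coprime B C \<Longrightarrow> A + B = C \<Longrightarrow>
      real_of_int \<bar>A * B * C\<bar> < real_of_int (int_radical (A * B * C)) powr t"
    using assms(1) unfolding weak_szpiro_def by blast
  have ps: "prime (ps ! i)" "ps ! i > 0" if "i < length ps" for i
    using assms(5) that by (simp_all add: prime_gt_0_nat)
  have As: "As ! j > 0" if "j < length As" for j
    using assms(8) that by simp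
  define c where "c = b * (\<Prod>i<length ps. int (ps ! i)) * (\<Prod>j<length As. int (As ! j))"
  have "c \<noteq> 0"
    unfolding c_def using assms(6) by (auto dest: ps(2) As)
  define K where "K = real_of_int (int_radical c)"
  have "K > 0"
    by (simp add: K_def int_radical_pos)
  obtain N where N: "\<And>M. fact M < (K * 4 ^ M) powr t \<Longrightarrow> M \<le> N"
    using fact_less_powr_bounded[OF \<open>K > 0\<close>] by blast
  \<comment> \<open>Szpiro's bound at the largest admissible \<open>M\<close>. It bounds the value
    of the form, and through divisibility every entry of a solution.\<close>
  define F where "F = nat \<lceil>(K * 4 ^ N) powr t\<rceil>"
  let ?L = "\<lambda>k. {zs :: nat list. set zs \<subseteq> {..F} \<and> length zs = k}"
  let ?I = "{- int F..int F}"
  have bounded: "(zs, ns, x, y) \<in> ?L (length ps) \<times> ?L (length As) \<times> ?I \<times> ?I"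
    if len: "length zs = length ps" "length ns = length As" and gcd: "gcd x y = 1"
      and eq: "b * (\<Prod>i<length ps. int (ps ! i) ^ (zs ! i))
        * (\<Prod>j<length As. fact (ns ! j) * int (As ! j) ^ (ns ! j)) = binary_form \<epsilon> s x y"
    for zs ns x y
  proof -
    define f where "f = binary_form \<epsilon> s x y"
    let ?P = "\<Prod>i<length ps. int (ps ! i) ^ (zs ! i)"
    let ?Q = "\<Prod>j<length As. fact (ns ! j) * int (As ! j) ^ (ns ! j)"
    have f: "f = b * ?P * ?Q"
      using eq by (simp add: f_def)
    have nz: "f \<noteq> 0"
      unfolding f using assms(6) by (auto dest: ps(2) As)
    have le: "\<bar>d\<bar> \<le> \<bar>f\<bar>" if "d dvd f" for d
      using that nz by (rule dvd_imp_le_int[rotated])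
    have z: "int (ps ! i) ^ (zs ! i) dvd f" if "i < length ps" for i
      unfolding f using that by (intro dvd_mult2 dvd_mult dvd_prodI) auto
    have n: "fact (ns ! j) dvd f" if "j < length As" for j
    proof -
      have "fact (ns ! j) * int (As ! j) ^ (ns ! j) dvd f"
        unfolding f using that by (intro dvd_mult dvd_prodI) auto
      then show ?thesis by (rule dvd_mult_left)
    qed
    have "ns \<noteq> []"
      using len assms(7) by auto
    define M where "M = Max (set ns)"
    have M: "M \<in> set ns" "\<And>j. j < length As \<Longrightarrow> ns ! j \<le> M"
      using \<open>ns \<noteq> []\<close> len by (auto simp: M_def)
    have rad: "int_radical f \<le> int_radical c * 4 ^ M"
    proof (rule int_radical_le[OF \<open>c \<noteq> 0\<close>])
      fix p :: int assume p: "prime p" "p dvd f"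
      then consider "p dvd b" | "p dvd ?P" | "p dvd ?Q"
        unfolding f by (auto simp: prime_dvd_mult_iff)
      then show "p dvd c \<or> p \<le> int M"
      proof cases
        case 1
        then show ?thesis by (simp add: c_def)
      next
        case 2
        then obtain i where i: "i < length ps" "p dvd int (ps ! i)"
          using p(1) by (auto simp: prime_dvd_prod_iff dest: prime_dvd_power)
        then have "p dvd (\<Prod>i<length ps. int (ps ! i))"
          by (meson dvd_prodI dvd_trans finite_lessThan lessThan_iff)
        then show ?thesis by (simp add: c_def)
      next
        case 3
        then obtain j where j: "j < length As" "p dvd fact (ns ! j) \<or> p dvd int (As ! j)"
          using p(1) by (auto simp: prime_dvd_prod_iff prime_dvd_mult_iff dest: prime_dvd_power)
        then consider "p dvd fact (ns ! j)" | "p dvd int (As ! j)"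
          by blast
        then show ?thesis
        proof cases
          case 1
          have "prime (nat p)" "int (nat p) = p"
            using iffD1[OF prime_int_nat_transfer p(1)] by auto
          moreover from this 1 have "int (nat p) dvd int (fact (ns ! j))"
            by simp
          ultimately have "nat p \<le> ns ! j"
            by (metis int_dvd_int_iff prime_dvd_fact_iff)
          then show ?thesis
            using M(2)[OF j(1)] by linarith
        next
          case 2
          then have "p dvd (\<Prod>j<length As. int (As ! j))"
            using j(1) by (meson dvd_prodI dvd_trans finite_lessThan lessThan_iff)
          then show ?thesis by (simp add: c_def)
        qed
      qed
    qed
    have "real_of_int \<bar>f\<bar> < real_of_int (int_radical f) powr t"
      unfolding f_def
      by (rule szpiro_binary_form[OF szpiro assms(3) gcd]) (use nz f_def in auto)
    also have "\<dots> \<le> (K * 4 ^ M) powr t"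
    proof (rule powr_mono2)
      have "real_of_int (int_radical f) \<le> real_of_int (int_radical c * 4 ^ M)"
        using rad by (simp only: of_int_le_iff)
      then show "real_of_int (int_radical f) \<le> K * 4 ^ M"
        by (simp add: K_def)
    qed (use \<open>t > 0\<close> int_radical_pos[of f] in auto)
    finally have fM: "real_of_int \<bar>f\<bar> < (K * 4 ^ M) powr t" .
    \<comment> \<open>\<open>M\<close> is itself one of the \<open>ns ! j\<close>, so
      \<open>M!\<close> divides \<open>f\<close> and is at most \<open>\<bar>f\<bar>\<close>.
      Combined with \<open>fM\<close>, this gives the inequality that forces
      \<open>M \<le> N\<close>.\<close>
    have "fact M dvd f"
      using M(1) n len by (metis in_set_conv_nth)
    from le[OF this] have "real_of_int (fact M) \<le> real_of_int \<bar>f\<bar>"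
      by (simp only: of_int_le_iff abs_of_nonneg fact_ge_zero)
    then have "M \<le> N"
      using fM by (intro N) simp
    then have "(K * 4 ^ M) powr t \<le> (K * 4 ^ N) powr t"
      using \<open>K > 0\<close> \<open>t > 0\<close> by (intro powr_mono2 mult_left_mono power_increasing) auto
    with fM have fF: "\<bar>f\<bar> \<le> int F"
      unfolding F_def by linarith
    \<comment> \<open>An exponent is smaller than the corresponding power of 2, hence than the prime
      power, which divides \<open>f\<close>.\<close>
    have "zs ! i \<le> F" if "i < length ps" for i
    proof -
      have "zs ! i < 2 ^ (zs ! i)"
        by (rule less_exp)
      also have "(2::nat) ^ (zs ! i) \<le> (ps ! i) ^ (zs ! i)"
        using ps(1)[OF that] by (intro power_mono) (auto dest: prime_ge_2_nat)
      also have "int ((ps ! i) ^ (zs ! i)) \<le> \<bar>f\<bar>"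
        using le[OF z[OF that]] by simp
      finally show ?thesis using fF by linarith
    qed
    then have zs: "set zs \<subseteq> {..F}"
      using len by (auto simp: in_set_conv_nth)
    have "ns ! j \<le> F" if "j < length As" for j
    proof -
      have "ns ! j \<le> fact (ns ! j)"
        by (rule fact_ge_self)
      also have "int (fact (ns ! j)) \<le> \<bar>f\<bar>"
        using le[OF n[OF that]] by simp
      finally show ?thesis using fF by linarith
    qed
    then have ns: "set ns \<subseteq> {..F}"
      using len by (auto simp: in_set_conv_nth)
    \<comment> \<open>Positivity of \<open>s\<close> makes both variables divisors of the nonzero
      integer \<open>f\<close>, which bounds them.\<close>
    have "x dvd x ^ s" "y dvd y ^ s"
      using assms(2) by auto
    then have "x dvd f" "y dvd f"
      unfolding f_def binary_form_factor by (auto intro: dvd_mult dvd_mult2)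
    then have "\<bar>x\<bar> \<le> int F" "\<bar>y\<bar> \<le> int F"
      using le fF by (meson order_trans)+
    then show ?thesis
      using zs ns len by auto
  qed
  have "?Sol \<subseteq> ?L (length ps) \<times> ?L (length As) \<times> ?I \<times> ?I"
  proof
    fix v assume "v \<in> ?Sol"
    then show "v \<in> ?L (length ps) \<times> ?L (length As) \<times> ?I \<times> ?I"
      by (cases v) (simp only: mem_Collect_eq prod.case, elim conjE, rule bounded)
  qed
  moreover have "finite (?L (length ps) \<times> ?L (length As) \<times> ?I \<times> ?I)"
    by (intro finite_cartesian_product finite_lists_length_eq) auto
  ultimately show ?thesis
    by (rule finite_subset)
qed

end
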